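(* Let $f\colon[m]^n\to\{0,1\}$ be a function. If there is a learning graph for $f$ (i.e. computing $f$) with complexity $C$, then $\mathrm{Adv}^{\pm}(f)\le C$.
   Context: $[m]=\{1,\dots,m\}$. For $x\in[m]^n$ and $S\subseteq[n]$, $x_S$ denotes the restriction of $x$ to $S$ (an element of $[m]^S$). Dual general adversary bound: $\mathrm{Adv}^{\pm}(f)$ is the minimum, over all $d\in\mathbb N$ and all families of vectors $u_{x,j}\in\mathbb C^d$ ($x\in[m]^n$, $j\in[n]$) satisfying $$\sum_{j:\,x_j\ne y_j}\langle u_{x,j}|u_{y,j}\rangle=1\quad\text{whenever } f(x)\ne f(y),$$ of $\max_x\sum_{j\in[n]}\|u_{x,j}\|^2$. Learning graph: a directed acyclic connected graph $\mathcal G$ whose vertices are labeled by subsets of $[n]$ (a vertex is identified with its label), including the root $\emptyset$, and whose arcs only go from a vertex $S$ to a vertex $S\cup\{j\}$ with $j\in[n]\setminus S$. Each arc $e$ with origin $S$ carries a weight function $w_e\colon[m]^S\to[0,\infty)$; for an input $x$ write $w_e(x)=w_e(x_S)$, and let $\mathcal G(x)$ be the graph with these real weights. A set $S$ contains a $1$-certificate for $x$ if every $z\in[m]^n$ with $z_S=x_S$ has $f(z)=1$; such a vertex $S$ is called accepting for $x$. The learning graph computes $f$ if for every $x\in f^{-1}(1)$ there is a vertex accepting for $x$. A flow on $\mathcal G(x)$, $x\in f^{-1}(1)$, is a real-valued function $p_e$ on arcs such that the sum of $p_e$ over arcs leaving $\emptyset$ is $1$, and for every vertex $S\neq\emptyset$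 that is not accepting for $x$ the sum of $p_e$ over incoming arcs equals the sum of $p_e$ over outgoing arcs. The complexity of the flow is $\sum_e p_e^2/w_e(x)$, with $0/0=0$ (and $a/0=+\infty$ for $a>0$). The negative complexity is $\mathcal N(\mathcal G)=\max_{y\in f^{-1}(0)}\sum_e w_e(y)$. The positive complexity is $\mathcal P(\mathcal G)=\max_{x\in f^{-1}(1)}\mathcal P(\mathcal G(x))$, where $\mathcal P(\mathcal G(x))$ is the smallest complexity of a flow on $\mathcal G(x)$. The complexity of $\mathcal G$ is $\sqrt{\mathcal N(\mathcal G)\,\mathcal P(\mathcal G)}$. *)

theory Defs
  imports
    Complex_Main
    "HOL-Library.FuncSet"
    "HOL-Library.Extended_Nonnegative_Real"
    "Jordan_Normal_Form.Conjugate"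
    "Jordan_Normal_Form.Matrix"
    "Graph_Theory.Graph_Theory"
begin

section \<open>Inputs\<close>

text \<open>The set \<open>[m]\<^sup>S\<close>; the restriction \<open>x\<^sub>S\<close> is then \<open>restrict x S\<close>.\<close>

definition inputs_on :: "nat \<Rightarrow> nat set \<Rightarrow> (nat \<Rightarrow> nat) set" where
  "inputs_on m S = S \<rightarrow>\<^sub>E {1..m}"

abbreviation inputs :: "nat \<Rightarrow> nat \<Rightarrow> (nat \<Rightarrow> nat) set" where
  "inputs m n \<equiv> inputs_on m {1..n}"


section \<open>The dual general adversary bound\<close>

definition norm2_vec :: "complex vec \<Rightarrow> real" where
  "norm2_vec v = (\<Sum>i<dim_vec v. (cmod (v $ i))\<^sup>2)"

text \<open>The product \<open>a \<bullet>c b\<close> is conjugate linear in its second argument, so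
  \<open>\<langle>a|b\<rangle>\<close> is \<open>b \<bullet>c a\<close>.\<close>

definition adv_feasible ::
  "nat \<Rightarrow> nat \<Rightarrow> ((nat \<Rightarrow> nat) \<Rightarrow> nat) \<Rightarrow> nat \<Rightarrow> ((nat \<Rightarrow> nat) \<Rightarrow> nat \<Rightarrow> complex vec) \<Rightarrow> bool" where
  "adv_feasible m n f d u \<longleftrightarrow>
     (\<forall>x\<in>inputs m n. \<forall>j\<in>{1..n}. u x j \<in> carrier_vec d) \<and>
     (\<forall>x\<in>inputs m n. \<forall>y\<in>inputs m n. f x \<noteq> f y \<longrightarrow>
        (\<Sum>j\<in>{j\<in>{1..n}. x j \<noteq> y j}. u y j \<bullet>c u x j) = 1)"

definition adv_objective ::
  "nat \<Rightarrow> nat \<Rightarrow> ((nat \<Rightarrow> nat) \<Rightarrow> nat \<Rightarrow> complex vec) \<Rightarrow> ennreal" where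
  "adv_objective m n u = (SUP x\<in>inputs m n. ennreal (\<Sum>j\<in>{1..n}. norm2_vec (u x j)))"

text \<open>Suprema and infima in \<^typ>\<open>ennreal\<close> stand for the maxima and minima. A maximum over no
  inputs is thereby 0, and a minimum over no candidates is \<open>\<infinity>\<close>.\<close>

definition Adv :: "nat \<Rightarrow> nat \<Rightarrow> ((nat \<Rightarrow> nat) \<Rightarrow> nat) \<Rightarrow> ennreal" where
  "Adv m n f = Inf {adv_objective m n u | d u. adv_feasible m n f d u}"


section \<open>Learning graphs\<close>

text \<open>A vertex is its label, and an arc is the pair of its end points.
  As in the graph library, \<open>connected\<close> refers to the underlying undirected graph.\<close>

locale learning_graph = pair_digraph G
  for m n :: nat and G :: "nat set pair_pre_digraph"
    and w :: "nat set \<times> nat set \<Rightarrow> (nat \<Rightarrow> nat) \<Rightarrow> real" +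
  assumes acyclic_arcs: "acyclic (parcs G)"
    and connected_graph: "Digraph_Component.connected (with_proj G)"
    and verts_subset: "pverts G \<subseteq> Pow {1..n}"
    and root_in_verts: "{} \<in> pverts G"
    and arc_insert: "(S, T) \<in> parcs G \<Longrightarrow> \<exists>j\<in>{1..n} - S. T = insert j S"
    and weight_nonneg: "(S, T) \<in> parcs G \<Longrightarrow> z \<in> inputs_on m S \<Longrightarrow> 0 \<le> w (S, T) z"

definition weight_at ::
  "(nat set \<times> nat set \<Rightarrow> (nat \<Rightarrow> nat) \<Rightarrow> real) \<Rightarrow> nat set \<times> nat set \<Rightarrow> (nat \<Rightarrow> nat) \<Rightarrow> real" where
  "weight_at w e x = w e (restrict x (fst e))"

definition contains_1_certificate ::
  "nat \<Rightarrow> nat \<Rightarrow> ((nat \<Rightarrow> nat) \<Rightarrow> nat) \<Rightarrow> (nat \<Rightarrow> nat) \<Rightarrow> nat set \<Rightarrow> bool" where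
  "contains_1_certificate m n f x S \<longleftrightarrow>
     (\<forall>z\<in>inputs m n. restrict z S = restrict x S \<longrightarrow> f z = 1)"

definition computes ::
  "nat \<Rightarrow> nat \<Rightarrow> nat set pair_pre_digraph \<Rightarrow> ((nat \<Rightarrow> nat) \<Rightarrow> nat) \<Rightarrow> bool" where
  "computes m n G f \<longleftrightarrow>
     (\<forall>x\<in>inputs m n. f x = 1 \<longrightarrow> (\<exists>S\<in>pverts G. contains_1_certificate m n f x S))"

definition is_flow ::
  "nat \<Rightarrow> nat \<Rightarrow> nat set pair_pre_digraph \<Rightarrow> ((nat \<Rightarrow> nat) \<Rightarrow> nat) \<Rightarrow> (nat \<Rightarrow> nat) \<Rightarrow>
   (nat set \<times> nat set \<Rightarrow> real) \<Rightarrow> bool" where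
  "is_flow m n G f x p \<longleftrightarrow>
     (\<Sum>e\<in>out_arcs (with_proj G) {}. p e) = 1 \<and>
     (\<forall>S\<in>pverts G. S \<noteq> {} \<longrightarrow> \<not> contains_1_certificate m n f x S \<longrightarrow>
        (\<Sum>e\<in>in_arcs (with_proj G) S. p e) = (\<Sum>e\<in>out_arcs (with_proj G) S. p e))"

text \<open>Division in \<^typ>\<open>ennreal\<close> has \<open>0 / 0 = 0\<close> and \<open>a / 0 = \<infinity>\<close> for \<open>a > 0\<close>.\<close>

definition flow_complexity ::
  "nat set pair_pre_digraph \<Rightarrow> (nat set \<times> nat set \<Rightarrow> (nat \<Rightarrow> nat) \<Rightarrow> real) \<Rightarrow> (nat \<Rightarrow> nat) \<Rightarrow>
   (nat set \<times> nat set \<Rightarrow> real) \<Rightarrow> ennreal" where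
  "flow_complexity G w x p = (\<Sum>e\<in>parcs G. ennreal ((p e)\<^sup>2) / ennreal (weight_at w e x))"

definition negative_complexity ::
  "nat \<Rightarrow> nat \<Rightarrow> nat set pair_pre_digraph \<Rightarrow> (nat set \<times> nat set \<Rightarrow> (nat \<Rightarrow> nat) \<Rightarrow> real) \<Rightarrow>
   ((nat \<Rightarrow> nat) \<Rightarrow> nat) \<Rightarrow> ennreal" where
  "negative_complexity m n G w f =
     (SUP y\<in>{y\<in>inputs m n. f y = 0}. ennreal (\<Sum>e\<in>parcs G. weight_at w e y))"

definition positive_complexity_at ::
  "nat \<Rightarrow> nat \<Rightarrow> nat set pair_pre_digraph \<Rightarrow> (nat set \<times> nat set \<Rightarrow> (nat \<Rightarrow> nat) \<Rightarrow> real) \<Rightarrow>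
   ((nat \<Rightarrow> nat) \<Rightarrow> nat) \<Rightarrow> (nat \<Rightarrow> nat) \<Rightarrow> ennreal" where
  "positive_complexity_at m n G w f x = Inf {flow_complexity G w x p | p. is_flow m n G f x p}"

definition positive_complexity ::
  "nat \<Rightarrow> nat \<Rightarrow> nat set pair_pre_digraph \<Rightarrow> (nat set \<times> nat set \<Rightarrow> (nat \<Rightarrow> nat) \<Rightarrow> real) \<Rightarrow>
   ((nat \<Rightarrow> nat) \<Rightarrow> nat) \<Rightarrow> ennreal" where
  "positive_complexity m n G w f =
     (SUP x\<in>{x\<in>inputs m n. f x = 1}. positive_complexity_at m n G w f x)"

text \<open>The negative complexity is always finite. An infinite positive complexity makes the
  complexity infinite also when the negative one is 0; the convention \<open>0 * \<infinity> = 0\<close> of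
  \<^typ>\<open>ennreal\<close> would assign complexity 0 to a graph with all weights 0.\<close>

definition complexity ::
  "nat \<Rightarrow> nat \<Rightarrow> nat set pair_pre_digraph \<Rightarrow> (nat set \<times> nat set \<Rightarrow> (nat \<Rightarrow> nat) \<Rightarrow> real) \<Rightarrow>
   ((nat \<Rightarrow> nat) \<Rightarrow> nat) \<Rightarrow> ennreal" where
  "complexity m n G w f =
     (if positive_complexity m n G w f = \<infinity> then \<infinity>
      else ennreal (sqrt (enn2real (negative_complexity m n G w f) *
                          enn2real (positive_complexity m n G w f))))"

end

theory Submission
  imports Defs
begin

text \<open>
  Index coordinates by pairs of an arc \<open>e\<close> from \<open>S\<close> to \<open>S \<union> {j}\<close> and a string in \<open>[m]\<^sup>S\<close>.
  An input \<open>x\<close> is sent to the vectors whose \<open>j\<close>-th member has, at \<open>(e, x\<^sub>S)\<close>, the entry \<open>\<surd>w\<^sub>e(x)\<close>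
  if \<open>f x = 0\<close>, and \<open>p\<^sub>e / \<surd>w\<^sub>e(x)\<close> if \<open>f x = 1\<close> and \<open>p\<close> is a flow on the graph for \<open>x\<close>.
  For \<open>f x = 1\<close> and \<open>f y = 0\<close> the sum of inner products is then the value of the flow across the
  cut around \<open>{S. x\<^sub>S = y\<^sub>S}\<close>. This set contains the root and no accepting vertex, and no arc
  enters it, so the value is 1. Rescaling the two kinds of vectors against each other turns the two
  squared norms into their geometric mean.
\<close>

section \<open>Restricted inputs, real coordinates and sums of extended reals\<close>

lemma finite_inputs_on: "finite S \<Longrightarrow> finite (inputs_on m S)"
  unfolding inputs_on_def by (intro finite_PiE) auto

lemma restrict_in_inputs_on: "x \<in> inputs m n \<Longrightarrow> S \<subseteq> {1..n} \<Longrightarrow> restrict x S \<in> inputs_on m S"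
  unfolding inputs_on_def by (auto simp: PiE_iff)

lemma restrict_eq_iff: "restrict x S = restrict y S \<longleftrightarrow> (\<forall>i\<in>S. x i = y i)"
  by (auto simp: restrict_def fun_eq_iff)

text \<open>Enumerating \<open>I\<close> turns coordinates indexed by any finite set into vectors of
  dimension \<open>card I\<close>. Since the entries are real, neither conjugation nor the order of
  the two factors matters.\<close>

lemma Adv_le_of_coordinates:
  fixes v :: "(nat \<Rightarrow> nat) \<Rightarrow> nat \<Rightarrow> 'i \<Rightarrow> real"
  assumes "finite I"
    and feasible: "\<And>x y. x \<in> inputs m n \<Longrightarrow> y \<in> inputs m n \<Longrightarrow> f x \<noteq> f y \<Longrightarrow>
          (\<Sum>j\<in>{j\<in>{1..n}. x j \<noteq> y j}. \<Sum>i\<in>I. v x j i * v y j i) = 1"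
    and bound: "\<And>x. x \<in> inputs m n \<Longrightarrow> (\<Sum>j\<in>{1..n}. \<Sum>i\<in>I. (v x j i)\<^sup>2) \<le> B"
  shows "Adv m n f \<le> ennreal B"
proof -
  obtain h where h: "bij_betw h {0..<card I} I"
    using ex_bij_betw_nat_finite[OF \<open>finite I\<close>] by blast
  define u where "u x j = vec (card I) (\<lambda>k. complex_of_real (v x j (h k)))" for x j
  have sum_I: "(\<Sum>k\<in>{0..<card I}. g (h k)) = (\<Sum>i\<in>I. g i)" for g :: "'i \<Rightarrow> real"
    using sum.reindex_bij_betw[OF h] .
  have inner: "u y j \<bullet>c u x j = complex_of_real (\<Sum>i\<in>I. v x j i * v y j i)" for x y j
    by (simp add: u_def scalar_prod_def mult.commute flip: sum_I)
  have norm: "norm2_vec (u x j) = (\<Sum>i\<in>I. (v x j i)\<^sup>2)" for x j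
    by (simp add: u_def norm2_vec_def lessThan_atLeast0 flip: sum_I)
  have "adv_feasible m n f (card I) u"
    unfolding adv_feasible_def inner using feasible
    by (auto simp: u_def simp flip: of_real_sum)
  then have "Adv m n f \<le> adv_objective m n u"
    unfolding Adv_def by (intro Inf_lower) blast
  also have "\<dots> \<le> ennreal B"
    unfolding adv_objective_def norm by (intro SUP_least ennreal_leI bound)
  finally show ?thesis .
qed

text \<open>A nonzero numerator over weight 0 would be an infinite summand, so finiteness excludes
  it. The remaining case \<open>0 / 0\<close> is 0 in both kinds of division.\<close>

lemma sum_ennreal_divide_finite:
  fixes a w :: "'e \<Rightarrow> real"
  assumes "finite E" and w: "\<And>e. e \<in> E \<Longrightarrow> 0 \<le> w e"
    and fin: "(\<Sum>e\<in>E. ennreal ((a e)\<^sup>2) / ennreal (w e)) < \<infinity>"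
  shows "(\<Sum>e\<in>E. ennreal ((a e)\<^sup>2) / ennreal (w e)) = ennreal (\<Sum>e\<in>E. (a e)\<^sup>2 / w e)"
    and "e \<in> E \<Longrightarrow> w e = 0 \<Longrightarrow> a e = 0"
proof -
  have zero: "a e = 0" if "e \<in> E" "w e = 0" for e
  proof (rule ccontr)
    assume "a e \<noteq> 0"
    then have "ennreal ((a e)\<^sup>2) / ennreal (w e) = \<infinity>"
      using that by (simp add: ennreal_divide_zero)
    then show False
      using fin that \<open>finite E\<close> by (simp add: sum.remove[of E e])
  qed
  then show "e \<in> E \<Longrightarrow> w e = 0 \<Longrightarrow> a e = 0" .
  have "(\<Sum>e\<in>E. ennreal ((a e)\<^sup>2) / ennreal (w e)) = (\<Sum>e\<in>E. ennreal ((a e)\<^sup>2 / w e))"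
  proof (rule sum.cong[OF refl])
    fix e assume "e \<in> E"
    then show "ennreal ((a e)\<^sup>2) / ennreal (w e) = ennreal ((a e)\<^sup>2 / w e)"
      using zero w[of e] by (cases "w e = 0") (auto simp: divide_ennreal)
  qed
  also have "\<dots> = ennreal (\<Sum>e\<in>E. (a e)\<^sup>2 / w e)"
    using w by (intro sum_ennreal) auto
  finally show "(\<Sum>e\<in>E. ennreal ((a e)\<^sup>2) / ennreal (w e)) = ennreal (\<Sum>e\<in>E. (a e)\<^sup>2 / w e)" .
qed

text \<open>Meaningful on arcs only, whose end points differ in exactly one element: the coordinate
  read along the arc.\<close>

definition added :: "nat set \<times> nat set \<Rightarrow> nat" where
  "added e = the_elem (snd e - fst e)"

section \<open>Arcs and the flow across a cut\<close>

context learning_graph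
begin

lemma arc_added:
  assumes "e \<in> parcs G"
  shows "fst e \<in> pverts G" "snd e \<in> pverts G" "fst e \<subseteq> {1..n}" "added e \<in> {1..n}"
    "snd e = insert (added e) (fst e)"
proof -
  obtain j where j: "j \<in> {1..n} - fst e" "snd e = insert j (fst e)"
    using arc_insert[of "fst e" "snd e"] assms by auto
  then have "snd e - fst e = {j}" by auto
  then show "added e \<in> {1..n}" "snd e = insert (added e) (fst e)"
    using j by (auto simp: added_def)
  show "fst e \<in> pverts G" "snd e \<in> pverts G"
    using assms by (auto intro: in_arcsD1 in_arcsD2 simp: prod.collapse)
  then show "fst e \<subseteq> {1..n}" using verts_subset by auto
qed

lemma weight_at_nonneg: "e \<in> parcs G \<Longrightarrow> x \<in> inputs m n \<Longrightarrow> 0 \<le> weight_at w e x"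
  using weight_nonneg[of "fst e" "snd e" "restrict x (fst e)"] arc_added(3)[of e]
    restrict_in_inputs_on[of x m n "fst e"]
  by (simp add: weight_at_def)

text \<open>Conservation is summed over the vertices on which \<open>x\<close> and \<open>y\<close>
  agree. The arcs inside this set cancel, and the root leaves a surplus of 1 to be carried by the
  arcs going out of it.\<close>

lemma flow_across_cut:
  assumes flow: "is_flow m n G f x p" and "y \<in> inputs m n" and "f y \<noteq> 1"
  shows "(\<Sum>e\<in>{e\<in>parcs G. restrict x (fst e) = restrict y (fst e) \<and> x (added e) \<noteq> y (added e)}.
            p e) = 1"
proof -
  define W where "W = {S\<in>pverts G. restrict x S = restrict y S}"
  have "finite W" by (simp add: W_def)
  have W_root: "{} \<in> W" using root_in_verts by (simp add: W_def restrict_eq_iff)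
  \<comment> \<open>Agreement on a set passes to its subsets, so no arc enters \<open>W\<close> from
    outside.\<close>
  have arc_W: "fst e \<in> W" if "e \<in> parcs G" "snd e \<in> W" for e
    using that arc_added[OF that(1)] by (auto simp: W_def restrict_eq_iff)
  have outs: "(\<Sum>S\<in>W. \<Sum>e\<in>out_arcs (with_proj G) S. p e) = (\<Sum>e\<in>{e\<in>parcs G. fst e \<in> W}. p e)"
  proof -
    have "out_arcs (with_proj G) S = {e \<in> {e\<in>parcs G. fst e \<in> W}. fst e = S}" if "S \<in> W" for S
      using that by (auto simp: out_arcs_def)
    then show ?thesis
      using sum.group[of "{e\<in>parcs G. fst e \<in> W}" W fst p] \<open>finite W\<close>
      by (simp add: image_subset_iff cong: sum.cong)
  qed
  have ins: "(\<Sum>S\<in>W. \<Sum>e\<in>in_arcs (with_proj G) S. p e) = (\<Sum>e\<in>{e\<in>parcs G. snd e \<in> W}. p e)"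
  proof -
    have "in_arcs (with_proj G) S = {e \<in> {e\<in>parcs G. snd e \<in> W}. snd e = S}" if "S \<in> W" for S
      using that by (auto simp: in_arcs_def)
    then show ?thesis
      using sum.group[of "{e\<in>parcs G. snd e \<in> W}" W snd p] \<open>finite W\<close>
      by (simp add: image_subset_iff cong: sum.cong)
  qed
  have in_root: "in_arcs (with_proj G) {} = {}"
    using arc_added(5) by (fastforce simp: in_arcs_def)
  \<comment> \<open>The root has no incoming arc, so the unit leaving it fits the same equation with
    the extra term 1.\<close>
  have balance: "(\<Sum>e\<in>out_arcs (with_proj G) S. p e) =
      (\<Sum>e\<in>in_arcs (with_proj G) S. p e) + (if S = {} then 1 else 0)" if "S \<in> W" for S
  proof -
    \<comment> \<open>The input \<open>y\<close> agrees with \<open>x\<close> on \<open>S\<close>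
      and has \<open>f y \<noteq> 1\<close>.\<close>
    have "\<not> contains_1_certificate m n f x S"
      using that assms by (auto simp: W_def contains_1_certificate_def)
    then show ?thesis
      using flow that in_root by (auto simp: is_flow_def W_def)
  qed
  have "(\<Sum>e\<in>{e\<in>parcs G. fst e \<in> W}. p e) = (\<Sum>e\<in>{e\<in>parcs G. snd e \<in> W}. p e) + 1"
    unfolding outs[symmetric] ins[symmetric]
    using \<open>finite W\<close> W_root by (simp add: balance sum.distrib)
  moreover have "{e\<in>parcs G. fst e \<in> W} = {e\<in>parcs G. snd e \<in> W} \<union>
      {e\<in>parcs G. fst e \<in> W \<and> snd e \<notin> W}"
    using arc_W by auto
  then have "(\<Sum>e\<in>{e\<in>parcs G. fst e \<in> W}. p e) =
      (\<Sum>e\<in>{e\<in>parcs G. snd e \<in> W}. p e) + (\<Sum>e\<in>{e\<in>parcs G. fst e \<in> W \<and> snd e \<notin> W}. p e)"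
    by (simp add: sum.union_disjoint disjoint_iff)
  \<comment> \<open>An arc leaves \<open>W\<close> exactly when the coordinate it adds is the first
    disagreement of \<open>x\<close> and \<open>y\<close> along it.\<close>
  moreover have "{e\<in>parcs G. fst e \<in> W \<and> snd e \<notin> W} =
      {e\<in>parcs G. restrict x (fst e) = restrict y (fst e) \<and> x (added e) \<noteq> y (added e)}"
  proof (rule Collect_cong)
    fix e
    show "e \<in> parcs G \<and> fst e \<in> W \<and> snd e \<notin> W \<longleftrightarrow> e \<in> parcs G \<and>
        restrict x (fst e) = restrict y (fst e) \<and> x (added e) \<noteq> y (added e)"
    proof (cases "e \<in> parcs G")
      case True
      then show ?thesis
        using arc_added(1,2)[OF True] unfolding W_def restrict_eq_iff arc_added(5)[OF True]
        by auto
    qed simp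
  qed
  ultimately show ?thesis by simp
qed

section \<open>The adversary vectors built from weights and flows\<close>

lemma Adv_le_of_flows:
  fixes A B :: real
  assumes f: "f \<in> inputs m n \<rightarrow> {0, 1}" and "0 < A" and "0 < B"
    and neg: "\<And>y. y \<in> inputs m n \<Longrightarrow> f y = 0 \<Longrightarrow> (\<Sum>e\<in>parcs G. weight_at w e y) \<le> A"
    and flow: "\<And>x. x \<in> inputs m n \<Longrightarrow> f x = 1 \<Longrightarrow> is_flow m n G f x (p x)"
    and pos: "\<And>x. x \<in> inputs m n \<Longrightarrow> f x = 1 \<Longrightarrow> flow_complexity G w x (p x) \<le> ennreal B"
  shows "Adv m n f \<le> ennreal (sqrt (A * B))"
proof -
  \<comment> \<open>The scale that makes both norm bounds equal: \<open>s * A\<close> for 0-inputs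
    and \<open>B / s\<close> for 1-inputs.\<close>
  define s where "s = sqrt (B / A)"
  have "s > 0" using \<open>0 < A\<close> \<open>0 < B\<close> by (simp add: s_def)
  have sA: "s * A = sqrt (A * B)" and sB: "B / s = sqrt (A * B)"
    using \<open>0 < A\<close> \<open>0 < B\<close> by (simp_all add: s_def real_sqrt_divide real_sqrt_mult field_simps)
  \<comment> \<open>At weight 0 the quotient is 0 by the convention for real division.\<close>
  define c where "c x e =
      (if f x = 0 then sqrt (s * weight_at w e x) else p x e / sqrt (s * weight_at w e x))" for x e
  \<comment> \<open>The string component makes inputs that differ on the origin of an arc orthogonal
    there.\<close>
  define I where "I = (SIGMA e:parcs G. inputs_on m (fst e))"
  define v where "v x j i =
      (if added (fst i) = j \<and> snd i = restrict x (fst (fst i)) then c x (fst i) else 0)"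
    for x j and i :: "(nat set \<times> nat set) \<times> (nat \<Rightarrow> nat)"
  have fin_on: "finite (inputs_on m (fst e))" if "e \<in> parcs G" for e
    using arc_added(3)[OF that] by (intro finite_inputs_on) (auto intro: finite_subset)
  have "finite I" using fin_on by (auto simp: I_def)
  \<comment> \<open>For each arc only the string \<open>restrict x (fst e)\<close> can contribute,
    and only if \<open>y\<close> has the same restriction. The set \<open>J\<close> will be the
    differing positions for inner products and all positions for norms.\<close>
  have collapse: "(\<Sum>j\<in>J. \<Sum>i\<in>I. v x j i * v y j i) =
      (\<Sum>e\<in>{e\<in>parcs G. restrict x (fst e) = restrict y (fst e) \<and> added e \<in> J}. c x e * c y e)"
    if x: "x \<in> inputs m n" and "finite J" for x y J
  proof -
    have "(\<Sum>\<alpha>\<in>inputs_on m (fst e). v x j (e, \<alpha>) * v y j (e, \<alpha>)) =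
        (if added e = j then if restrict x (fst e) = restrict y (fst e) then c x e * c y e else 0
         else 0)"
      if "e \<in> parcs G" for e j
    proof -
      have "v x j (e, \<alpha>) * v y j (e, \<alpha>) =
          (if \<alpha> = restrict x (fst e) then
             if added e = j \<and> restrict x (fst e) = restrict y (fst e) then c x e * c y e else 0
           else 0)" for \<alpha>
        by (auto simp: v_def)
      then show ?thesis
        using fin_on[OF that] restrict_in_inputs_on[OF x arc_added(3)[OF that]] by simp
    qed
    moreover have "(\<Sum>i\<in>I. v x j i * v y j i) =
        (\<Sum>e\<in>parcs G. \<Sum>\<alpha>\<in>inputs_on m (fst e). v x j (e, \<alpha>) * v y j (e, \<alpha>))" for j
      using fin_on by (simp add: I_def sum.Sigma split_def)
    ultimately have "(\<Sum>j\<in>J. \<Sum>i\<in>I. v x j i * v y j i) =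
        (\<Sum>j\<in>J. \<Sum>e\<in>parcs G. if added e = j then
            if restrict x (fst e) = restrict y (fst e) then c x e * c y e else 0 else 0)"
      by simp
    also have "\<dots> = (\<Sum>e\<in>parcs G. if added e \<in> J then
            if restrict x (fst e) = restrict y (fst e) then c x e * c y e else 0 else 0)"
      using \<open>finite J\<close> by (subst sum.swap) simp
    also have "\<dots> = (\<Sum>e\<in>{e\<in>parcs G. restrict x (fst e) = restrict y (fst e) \<and> added e \<in> J}.
        c x e * c y e)"
      by (auto simp: sum.inter_filter intro!: sum.cong)
    finally show ?thesis .
  qed
  have complexity: "(\<Sum>e\<in>parcs G. (p x e)\<^sup>2 / weight_at w e x) \<le> B"
    and no_weight: "\<And>e. e \<in> parcs G \<Longrightarrow> weight_at w e x = 0 \<Longrightarrow> p x e = 0"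
    if "x \<in> inputs m n" "f x = 1" for x
  proof -
    have "flow_complexity G w x (p x) < \<infinity>"
      using pos[OF that] by (simp add: le_less_trans ennreal_less_top)
    note * = sum_ennreal_divide_finite[where a = "p x" and w = "\<lambda>e. weight_at w e x",
        OF pair_finite_arcs weight_at_nonneg[OF _ that(1)] this[unfolded flow_complexity_def],
        folded flow_complexity_def]
    show "(\<Sum>e\<in>parcs G. (p x e)\<^sup>2 / weight_at w e x) \<le> B"
      using pos[OF that] *(1) \<open>0 < B\<close> by (simp add: ennreal_le_iff)
    show "\<And>e. e \<in> parcs G \<Longrightarrow> weight_at w e x = 0 \<Longrightarrow> p x e = 0"
      using *(2) by blast
  qed
  have inner: "(\<Sum>j\<in>{j\<in>{1..n}. x j \<noteq> y j}. \<Sum>i\<in>I. v x j i * v y j i) = 1"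
    if x: "x \<in> inputs m n" "f x = 1" and y: "y \<in> inputs m n" "f y = 0" for x y
  proof -
    have "c x e * c y e = p x e" if e: "e \<in> parcs G" "restrict x (fst e) = restrict y (fst e)" for e
    proof -
      \<comment> \<open>The weight depends only on the restriction to the origin, so the square
        roots cancel. At weight 0 both sides vanish because \<open>p x e = 0\<close>.\<close>
      have "weight_at w e y = weight_at w e x" using e by (simp add: weight_at_def)
      then show ?thesis
        using x y no_weight[OF x e(1)] \<open>s > 0\<close> by (simp add: c_def)
    qed
    then have "(\<Sum>j\<in>{j\<in>{1..n}. x j \<noteq> y j}. \<Sum>i\<in>I. v x j i * v y j i) =
      (\<Sum>e\<in>{e\<in>parcs G. restrict x (fst e) = restrict y (fst e) \<and> x (added e) \<noteq> y (added e)}. p x e)"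
      using x arc_added(4) by (subst collapse) (auto intro!: sum.cong)
    then show ?thesis using flow_across_cut[OF flow[OF x] y(1)] y(2) by simp
  qed
  have norms: "(\<Sum>j\<in>{1..n}. \<Sum>i\<in>I. (v x j i)\<^sup>2) \<le> sqrt (A * B)" if x: "x \<in> inputs m n" for x
  proof -
    \<comment> \<open>For \<open>y = x\<close> the agreement condition is void, and each arc counts
      once, at the coordinate it adds.\<close>
    have "(\<Sum>j\<in>{1..n}. \<Sum>i\<in>I. (v x j i)\<^sup>2) = (\<Sum>e\<in>parcs G. (c x e)\<^sup>2)"
      unfolding power2_eq_square using x arc_added(4)
      by (subst collapse) (auto intro!: sum.cong)
    also have "\<dots> \<le> sqrt (A * B)"
    proof (cases "f x = 0")
      case True
      then have "(\<Sum>e\<in>parcs G. (c x e)\<^sup>2) = s * (\<Sum>e\<in>parcs G. weight_at w e x)"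
        using \<open>s > 0\<close> weight_at_nonneg[OF _ x] by (simp add: c_def sum_distrib_left)
      also have "\<dots> \<le> s * A"
        using neg[OF x True] \<open>s > 0\<close> by simp
      finally show ?thesis by (simp add: sA)
    next
      case False
      then have "f x = 1" using funcset_mem[OF f x] by simp
      have "(\<Sum>e\<in>parcs G. (c x e)\<^sup>2) = (\<Sum>e\<in>parcs G. (p x e)\<^sup>2 / weight_at w e x) / s"
        using \<open>s > 0\<close> False weight_at_nonneg[OF _ x]
        by (simp add: c_def power_divide sum_divide_distrib mult.commute)
      also have "\<dots> \<le> B / s"
        using complexity[OF x \<open>f x = 1\<close>] \<open>s > 0\<close> by (simp add: divide_right_mono)
      finally show ?thesis by (simp add: sB)
    qed
    finally show ?thesis .
  qed
  show ?thesis
  proof (rule Adv_le_of_coordinates[OF \<open>finite I\<close> _ norms])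
    fix x y assume x: "x \<in> inputs m n" and y: "y \<in> inputs m n" and "f x \<noteq> f y"
    then consider "f x = 1" "f y = 0" | "f y = 1" "f x = 0"
      using funcset_mem[OF f x] funcset_mem[OF f y] by auto
    then show "(\<Sum>j\<in>{j\<in>{1..n}. x j \<noteq> y j}. \<Sum>i\<in>I. v x j i * v y j i) = 1"
    proof cases
      case 1
      then show ?thesis using inner x y by simp
    next
      \<comment> \<open>The condition is symmetric in \<open>x\<close> and \<open>y\<close> because
        the coordinates are real.\<close>
      case 2
      then show ?thesis using inner[OF y _ x] by (simp add: mult.commute eq_commute[of "x _"])
    qed
  qed
qed

section \<open>Finiteness of the negative complexity and passage to the limit\<close>

lemma negative_complexity_finite: "negative_complexity m n G w f < \<infinity>"
proof -
  \<comment> \<open>The supremum is dominated by the sum over all inputs, of which there are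
    finitely many.\<close>
  have "ennreal (\<Sum>e\<in>parcs G. weight_at w e y) \<le>
      (\<Sum>y\<in>inputs m n. ennreal (\<Sum>e\<in>parcs G. weight_at w e y))" if "y \<in> inputs m n" for y
    using that finite_inputs_on[of "{1..n}" m] by (simp add: sum.remove[of _ y])
  then have "negative_complexity m n G w f \<le>
      (\<Sum>y\<in>inputs m n. ennreal (\<Sum>e\<in>parcs G. weight_at w e y))"
    unfolding negative_complexity_def by (intro SUP_least) auto
  also have "\<dots> < \<infinity>" by (simp add: ennreal_sum_less_top finite_inputs_on)
  finally show ?thesis .
qed

lemma Adv_le_complexity:
  assumes f: "f \<in> inputs m n \<rightarrow> {0, 1}"
  shows "Adv m n f \<le> complexity m n G w f"
proof (cases "positive_complexity m n G w f = \<infinity>")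
  case True
  then show ?thesis by (simp add: complexity_def)
next
  case False
  define N where "N = enn2real (negative_complexity m n G w f)"
  define P where "P = enn2real (positive_complexity m n G w f)"
  have N: "negative_complexity m n G w f = ennreal N"
    and P: "positive_complexity m n G w f = ennreal P"
    using False negative_complexity_finite[of f] by (simp_all add: N_def P_def less_top)
  have "0 \<le> N" "0 \<le> P" by (simp_all add: N_def P_def)
  \<comment> \<open>The slack makes both bounds positive and stands in for a flow attaining the infimum.\<close>
  have slack: "Adv m n f \<le> ennreal (sqrt ((N + \<epsilon>) * (P + \<epsilon>)))" if "\<epsilon> > 0" for \<epsilon>
  proof -
    have "\<exists>p. is_flow m n G f x p \<and> flow_complexity G w x p \<le> ennreal (P + \<epsilon>)"
      if x: "x \<in> inputs m n" "f x = 1" for x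
    proof -
      have "positive_complexity_at m n G w f x \<le> ennreal P"
        unfolding P[symmetric] positive_complexity_def using x by (intro SUP_upper) simp
      also have "\<dots> < ennreal (P + \<epsilon>)"
        using \<open>0 \<le> P\<close> \<open>\<epsilon> > 0\<close> by (simp add: ennreal_lessI)
      finally show ?thesis
        unfolding positive_complexity_at_def Inf_less_iff by (auto intro: less_imp_le)
    qed
    then obtain p where p: "\<And>x. x \<in> inputs m n \<Longrightarrow> f x = 1 \<Longrightarrow>
        is_flow m n G f x (p x) \<and> flow_complexity G w x (p x) \<le> ennreal (P + \<epsilon>)"
      by metis
    have "(\<Sum>e\<in>parcs G. weight_at w e y) \<le> N + \<epsilon>" if y: "y \<in> inputs m n" "f y = 0" for y
    proof -
      have "ennreal (\<Sum>e\<in>parcs G. weight_at w e y) \<le> ennreal N"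
        unfolding N[symmetric] negative_complexity_def using y by (intro SUP_upper) simp
      then show ?thesis using \<open>0 \<le> N\<close> \<open>\<epsilon> > 0\<close> by (simp add: ennreal_le_iff)
    qed
    then show ?thesis
      using p \<open>0 \<le> N\<close> \<open>0 \<le> P\<close> \<open>\<epsilon> > 0\<close> by (intro Adv_le_of_flows[OF f, of _ _ p]) auto
  qed
  \<comment> \<open>The square root is continuous at 0 too, so the limit also covers
    \<open>N = 0\<close> and \<open>P = 0\<close>, where the scale between the two kinds of vectors
    would degenerate.\<close>
  have "((\<lambda>\<epsilon>. ennreal (sqrt ((N + \<epsilon>) * (P + \<epsilon>)))) \<longlongrightarrow> ennreal (sqrt ((N + 0) * (P + 0)))) (at_right 0)"
    by (intro tendsto_intros tendsto_ennrealI)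
  moreover have "\<forall>\<^sub>F \<epsilon> in at_right 0. Adv m n f \<le> ennreal (sqrt ((N + \<epsilon>) * (P + \<epsilon>)))"
    by (rule eventually_mono[OF eventually_at_right_less]) (rule slack)
  ultimately have "Adv m n f \<le> ennreal (sqrt ((N + 0) * (P + 0)))"
    by (intro tendsto_lowerbound) auto
  then show ?thesis using False by (simp add: complexity_def N_def P_def)
qed

end

theorem theorem9:
  fixes m n :: nat and f :: "(nat \<Rightarrow> nat) \<Rightarrow> nat" and C :: ennreal
  assumes "f \<in> inputs m n \<rightarrow> {0, 1}"
    and "\<exists>G w. learning_graph m n G w \<and> computes m n G f \<and> complexity m n G w f = C"
  shows "Adv m n f \<le> C"
  using assms learning_graph.Adv_le_complexity by blast

end
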